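(* (Mixed meet property.) Let $W$ be a finite Coxeter group and let $u,w\in W$. Then the set $$\{x\in W : x\leqslant_R u,\ x\leqslant w\}$$ has a unique maximal element $m$ for the Bruhat order. This means that $m\leqslant_R u$, $m\leqslant w$, and if $v\in W$ satisfies $v\leqslant_R u$ and $v\leqslant w$ then $v\leqslant m$. Moreover $$m=u\,(u^{-1}\downarrow U_w).$$
   Context: $W$ is a finite Coxeter group with simple reflections $s_1,\dots,s_r$ and length function $\ell$. $\leqslant$ is the (strong) Bruhat order. The weak order is defined by $x\leqslant_R u$ iff $\ell(x)+\ell(x^{-1}u)=\ell(u)$. For $v\in W$ and a simple reflection $s_i$, let $v\downarrow U_i=v$ if $vs_i>v$ and $v\downarrow U_i=vs_i$ if $vs_i<v$. For $w\in W$ with reduced expression $w=s_{i_1}\cdots s_{i_k}$ let $v\downarrow U_w=(\cdots((v\downarrow U_{i_1})\downarrow U_{i_2})\cdots)\downarrow U_{i_k}$; this is independent of the reduced expression. *)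

theory Defs
  imports "HOL-Algebra.Algebra"
begin

definition word_prod :: "('a, 'b) monoid_scheme \<Rightarrow> 'a list \<Rightarrow> 'a" where
  "word_prod W ws = foldr (\<lambda>x y. x \<otimes>\<^bsub>W\<^esub> y) ws \<one>\<^bsub>W\<^esub>"

text \<open>
  The congruence on words in \<open>S\<close> generated by \<open>(s t)\<^sup>m = 1\<close>, where \<open>m\<close> is the order
  of \<open>s \<otimes> t\<close> in \<open>W\<close>.  Since \<open>group.ord\<close> is 0 for elements of infinite order, such pairs
  contribute only a trivial relation.  For \<open>s = t\<close> an involution, \<open>m = 1\<close> and the relation
  is \<open>s s = 1\<close>; therefore no letters for inverses are needed, and the quotient of
  \<open>lists S\<close> is the group presented by these relations.
\<close>

inductive coxeter_cong :: "('a, 'b) monoid_scheme \<Rightarrow> 'a set \<Rightarrow> 'a list \<Rightarrow> 'a list \<Rightarrow> bool"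
  for W S where
  relation: "\<lbrakk>s \<in> S; t \<in> S; xs \<in> lists S; ys \<in> lists S\<rbrakk> \<Longrightarrow>
    coxeter_cong W S (xs @ concat (replicate (group.ord W (s \<otimes>\<^bsub>W\<^esub> t)) [s, t]) @ ys) (xs @ ys)"
| refl: "xs \<in> lists S \<Longrightarrow> coxeter_cong W S xs xs"
| sym: "coxeter_cong W S xs ys \<Longrightarrow> coxeter_cong W S ys xs"
| trans: "\<lbrakk>coxeter_cong W S xs ys; coxeter_cong W S ys zs\<rbrakk> \<Longrightarrow> coxeter_cong W S xs zs"

text \<open>
  Coxeter systems as in Bourbaki: \<open>W\<close> is generated by the set \<open>S\<close> of elements of order 2 and
  is presented by the relations \<open>(s t)\<^sup>m = 1\<close> above.  The converse of \<open>presentation\<close>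
  (congruent words have equal products) holds in every group.
\<close>

locale coxeter_system = group W for W :: "('a, 'b) monoid_scheme" (structure) +
  fixes S :: "'a set"
  assumes generators: "S \<subseteq> carrier W"
    and involution: "s \<in> S \<Longrightarrow> s \<noteq> \<one> \<and> s \<otimes> s = \<one>"
    and generated: "generate W S = carrier W"
    and presentation: "\<lbrakk>xs \<in> lists S; ys \<in> lists S; word_prod W xs = word_prod W ys\<rbrakk>
      \<Longrightarrow> coxeter_cong W S xs ys"

definition cox_length :: "('a, 'b) monoid_scheme \<Rightarrow> 'a set \<Rightarrow> 'a \<Rightarrow> nat" where
  "cox_length W S w = (LEAST k. \<exists>ws \<in> lists S. length ws = k \<and> word_prod W ws = w)"

definition reduced_expr :: "('a, 'b) monoid_scheme \<Rightarrow> 'a set \<Rightarrow> 'a list \<Rightarrow> 'a \<Rightarrow> bool" where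
  "reduced_expr W S ws w \<longleftrightarrow>
     ws \<in> lists S \<and> word_prod W ws = w \<and> length ws = cox_length W S w"

definition reflections :: "('a, 'b) monoid_scheme \<Rightarrow> 'a set \<Rightarrow> 'a set" where
  "reflections W S = {x \<otimes>\<^bsub>W\<^esub> s \<otimes>\<^bsub>W\<^esub> inv\<^bsub>W\<^esub> x | x s. x \<in> carrier W \<and> s \<in> S}"

definition bruhat_step :: "('a, 'b) monoid_scheme \<Rightarrow> 'a set \<Rightarrow> 'a \<Rightarrow> 'a \<Rightarrow> bool" where
  "bruhat_step W S x y \<longleftrightarrow>
     (\<exists>t \<in> reflections W S. y = x \<otimes>\<^bsub>W\<^esub> t) \<and> cox_length W S x < cox_length W S y"

definition bruhat_le :: "('a, 'b) monoid_scheme \<Rightarrow> 'a set \<Rightarrow> 'a \<Rightarrow> 'a \<Rightarrow> bool" where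
  "bruhat_le W S x y \<longleftrightarrow> x \<in> carrier W \<and> (bruhat_step W S)\<^sup>*\<^sup>* x y"

definition bruhat_less :: "('a, 'b) monoid_scheme \<Rightarrow> 'a set \<Rightarrow> 'a \<Rightarrow> 'a \<Rightarrow> bool" where
  "bruhat_less W S x y \<longleftrightarrow> bruhat_le W S x y \<and> x \<noteq> y"

definition weak_le :: "('a, 'b) monoid_scheme \<Rightarrow> 'a set \<Rightarrow> 'a \<Rightarrow> 'a \<Rightarrow> bool" where
  "weak_le W S x u \<longleftrightarrow> x \<in> carrier W \<and> u \<in> carrier W \<and>
     cox_length W S x + cox_length W S (inv\<^bsub>W\<^esub> x \<otimes>\<^bsub>W\<^esub> u) = cox_length W S u"

text \<open>For \<open>s \<in> S\<close> exactly one of \<open>v s < v\<close> and \<open>v < v s\<close> holds.\<close>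

definition down_simple :: "('a, 'b) monoid_scheme \<Rightarrow> 'a set \<Rightarrow> 'a \<Rightarrow> 'a \<Rightarrow> 'a" where
  "down_simple W S v s = (if bruhat_less W S (v \<otimes>\<^bsub>W\<^esub> s) v then v \<otimes>\<^bsub>W\<^esub> s else v)"

text \<open>
  The common value of the iterated operation over all reduced expressions of \<open>w\<close>.  The
  definite description makes independence of the reduced expression part of every
  statement about \<open>down\<close>.
\<close>

definition down :: "('a, 'b) monoid_scheme \<Rightarrow> 'a set \<Rightarrow> 'a \<Rightarrow> 'a \<Rightarrow> 'a" where
  "down W S v w = (THE y. \<exists>ws. reduced_expr W S ws w \<and> y = foldl (down_simple W S) v ws)"

end

theory Submission
  imports Defs
begin

text \<open>
  Let \<open>m = u (u\<^sup>-\<^sup>1 \<down> U\<^sub>w)\<close>.  By the lifting property, \<open>v \<down> U\<^sub>w\<close> is the Bruhat minimum of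
  \<open>{v y | y \<le> w}\<close>; in particular it does not depend on the reduced expression, and
  \<open>m \<le> w\<close>.  Every proper step of the iteration lowers the length by one, which gives
  \<open>m \<le>\<^sub>R u\<close>.  If \<open>v \<le>\<^sub>R u\<close> and \<open>v \<le> w\<close>, minimality gives \<open>u\<^sup>-\<^sup>1 m \<le> u\<^sup>-\<^sup>1 v =: q\<close>.
  The minimum of \<open>{u y | y \<le> q}\<close> has length at least \<open>\<ell>(u) - \<ell>(q) = \<ell>(v)\<close> and lies below
  \<open>u q = v\<close>, so it is \<open>v\<close>; as \<open>m = u (u\<^sup>-\<^sup>1 m)\<close> belongs to this set, \<open>v \<le> m\<close>.
\<close>

section \<open>Products of words and parity counting\<close>

lemma word_prod_Nil [simp]: "word_prod W [] = \<one>\<^bsub>W\<^esub>"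
  by (simp add: word_prod_def)

lemma word_prod_Cons [simp]: "word_prod W (s # ws) = s \<otimes>\<^bsub>W\<^esub> word_prod W ws"
  by (simp add: word_prod_def)

text \<open>Translation by \<open>m\<close> matches the solutions below \<open>m\<close> with those
  from \<open>m\<close> to \<open>2 * m\<close>. This is applied to the letters of the relator
  \<open>(s t)^m\<close>, which number \<open>2 * m\<close>.\<close>

lemma even_card_periodic:
  fixes P :: "nat \<Rightarrow> bool"
  assumes "\<And>i. P (i + m) = P i"
  shows "even (card {i. i < 2 * m \<and> P i})"
proof -
  have "{i. i < 2 * m \<and> P i} = {i. i < m \<and> P i} \<union> (\<lambda>i. i + m) ` {i. i < m \<and> P i}"
    (is "_ = ?A \<union> ?B")
  proof (intro equalityI subsetI)
    fix i assume "i \<in> {i. i < 2 * m \<and> P i}"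
    then show "i \<in> ?A \<union> ?B"
      using assms[of "i - m"] by (cases "i < m") (auto intro!: image_eqI[of _ _ "i - m"])
  qed (use assms in auto)
  moreover have "card (?A \<union> ?B) = card ?A + card ?B"
    by (rule card_Un_disjoint) auto
  moreover have "card ?B = card ?A"
    by (rule card_image) auto
  ultimately show ?thesis by simp
qed

lemma odd_card_Suc:
  "odd (card {i. i < Suc n \<and> P i}) \<longleftrightarrow> (odd (card {i. i < n \<and> P i}) \<noteq> P n)"
proof -
  have "{i. i < Suc n \<and> P i} =
      (if P n then insert n {i. i < n \<and> P i} else {i. i < n \<and> P i})"
    by (auto simp: less_Suc_eq)
  then show ?thesis by simp
qed

context coxeter_system
begin

section \<open>Words in the generators and the length function\<close>

abbreviation len :: "'a \<Rightarrow> nat" where "len \<equiv> cox_length W S"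
abbreviation wprod :: "'a list \<Rightarrow> 'a" where "wprod \<equiv> word_prod W"

lemma S_carrier [simp]: "s \<in> S \<Longrightarrow> s \<in> carrier W"
  using generators by auto

lemma S_square [simp]: "s \<in> S \<Longrightarrow> s \<otimes> s = \<one>"
  using involution by auto

lemma S_inv [simp]: "s \<in> S \<Longrightarrow> inv s = s"
  by (simp add: inv_equality)

lemma S_cancel [simp]:
  assumes "s \<in> S" "x \<in> carrier W"
  shows "s \<otimes> (s \<otimes> x) = x" "x \<otimes> s \<otimes> s = x"
  using assms m_assoc[of s s x] m_assoc[of x s s] by simp_all

lemma inv_cancel [simp]:
  assumes "x \<in> carrier W" "y \<in> carrier W"
  shows "inv x \<otimes> (x \<otimes> y) = y" "x \<otimes> (inv x \<otimes> y) = y"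
  using assms m_assoc[of "inv x" x y] m_assoc[of x "inv x" y] by simp_all

declare in_lists_conv_set [simp]

lemma wprod_closed [simp]: "ws \<in> lists S \<Longrightarrow> wprod ws \<in> carrier W"
  by (induction ws) auto

lemma wprod_append:
  "\<lbrakk>xs \<in> lists S; ys \<in> lists S\<rbrakk> \<Longrightarrow> wprod (xs @ ys) = wprod xs \<otimes> wprod ys"
  by (induction xs) (auto simp: m_assoc)

lemma wprod_rev: "ws \<in> lists S \<Longrightarrow> wprod (rev ws) = inv (wprod ws)"
  by (induction ws) (auto simp: wprod_append inv_mult_group)

lemma word_exists:
  assumes "w \<in> carrier W"
  obtains ws where "ws \<in> lists S" "wprod ws = w"
proof -
  have "w \<in> generate W S" using assms generated by simp
  then have "\<exists>ws \<in> lists S. wprod ws = w"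
  proof (induction rule: generate.induct)
    case one
    show ?case by (rule bexI[of _ "[]"]) auto
  next
    case (incl h)
    then show ?case by (intro bexI[of _ "[h]"]) auto
  next
    \<comment> \<open>Generators are involutions, so the inverse of one is again a one-letter
      word.\<close>
    case (inv h)
    then show ?case by (intro bexI[of _ "[h]"]) auto
  next
    case (eng h1 h2)
    then show ?case by (metis wprod_append append_in_lists_conv)
  qed
  with that show ?thesis by blast
qed

lemma len_le: "ws \<in> lists S \<Longrightarrow> len (wprod ws) \<le> length ws"
  unfolding cox_length_def by (rule Least_le) auto

lemma reduced_exists:
  assumes "w \<in> carrier W"
  obtains ws where "reduced_expr W S ws w"
proof -
  obtain ws where "ws \<in> lists S" "wprod ws = w"
    using word_exists assms by blast
  then have "\<exists>k. \<exists>ws \<in> lists S. length ws = k \<and> wprod ws = w"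
    by blast
  from LeastI_ex[OF this] obtain vs
    where "vs \<in> lists S" "length vs = len w" "wprod vs = w"
    unfolding cox_length_def by blast
  then show ?thesis using that by (auto simp: reduced_expr_def)
qed

lemma len_mult:
  assumes "x \<in> carrier W" "y \<in> carrier W"
  shows "len (x \<otimes> y) \<le> len x + len y"
proof -
  obtain xs ys where "reduced_expr W S xs x" "reduced_expr W S ys y"
    using reduced_exists assms by meson
  then show ?thesis
    using len_le[of "xs @ ys"] by (auto simp: reduced_expr_def wprod_append)
qed

lemma len_inv_le:
  assumes "x \<in> carrier W"
  shows "len (inv x) \<le> len x"
proof -
  obtain xs where "reduced_expr W S xs x"
    using reduced_exists assms by meson
  then show ?thesis
    using len_le[of "rev xs"] by (auto simp: reduced_expr_def wprod_rev)
qed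

lemma len_inv [simp]: "x \<in> carrier W \<Longrightarrow> len (inv x) = len x"
  using len_inv_le[of x] len_inv_le[of "inv x"] by simp

lemma len_one [simp]: "len \<one> = 0"
  using len_le[of "[]"] by simp

lemma len_gen_le: "s \<in> S \<Longrightarrow> len s \<le> 1"
  using len_le[of "[s]"] by simp

lemma len_mult_gen: "\<lbrakk>x \<in> carrier W; s \<in> S\<rbrakk> \<Longrightarrow> len (x \<otimes> s) \<le> len x + 1"
  using len_mult[of x s] len_gen_le[of s] by simp

subsection \<open>Inversions and strong exchange\<close>

text \<open>
  Parity of the number of suffixes \<open>s # ps\<close> of a word for which \<open>t = p\<^sup>-\<^sup>1 s p\<close>, where \<open>p\<close> is
  the product of \<open>ps\<close>.
\<close>

primrec odd_refl :: "'a list \<Rightarrow> 'a \<Rightarrow> bool" where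
  "odd_refl [] t = False"
| "odd_refl (s # ws) t = (odd_refl ws t \<noteq> (wprod ws \<otimes> t = s \<otimes> wprod ws))"

text \<open>A suffix starting inside \<open>xs\<close> has the form \<open>s # ps @ ys\<close>; its
  equation for \<open>t\<close> is the equation of \<open>s # ps\<close> for the conjugate of
  \<open>t\<close> by the product of \<open>ys\<close>. This is the cocycle identity at the level of
  words.\<close>

lemma odd_refl_append:
  assumes "xs \<in> lists S" "ys \<in> lists S" "t \<in> carrier W"
  shows "odd_refl (xs @ ys) t =
    (odd_refl xs (wprod ys \<otimes> t \<otimes> inv (wprod ys)) \<noteq> odd_refl ys t)"
  using assms(1)
proof (induction xs)
  case (Cons s xs)
  let ?x = "wprod xs" and ?y = "wprod ys"
  have [simp]: "?x \<in> carrier W" "?y \<in> carrier W" "s \<in> carrier W"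
    using Cons assms by auto
  \<comment> \<open>Inserting \<open>inv ?y \<otimes> ?y\<close> after \<open>t\<close> makes
    \<open>?y\<close> a common right factor that can be cancelled.\<close>
  have "?x \<otimes> ?y \<otimes> t = s \<otimes> (?x \<otimes> ?y) \<longleftrightarrow>
      ?x \<otimes> (?y \<otimes> t \<otimes> inv ?y) \<otimes> ?y = s \<otimes> ?x \<otimes> ?y"
    using assms by (simp add: m_assoc)
  also have "\<dots> \<longleftrightarrow> ?x \<otimes> (?y \<otimes> t \<otimes> inv ?y) = s \<otimes> ?x"
    using assms by (subst r_cancel) simp_all
  finally show ?case
    using Cons assms by (auto simp: wprod_append)
qed simp

section \<open>Dihedral words and invariance under the Coxeter relations\<close>

lemma wprod_dihedral:
  assumes "s \<in> S" "t \<in> S"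
  shows "wprod (concat (replicate n [s, t])) = (s \<otimes> t) [^] n"
proof (induction n)
  case (Suc n)
  have "(s \<otimes> t) [^] Suc n = (s \<otimes> t) \<otimes> (s \<otimes> t) [^] n"
    using assms by (intro nat_pow_Suc2) simp
  then show ?case
    using Suc assms by (simp add: m_assoc del: nat_pow_Suc)
qed simp

text \<open>Conjugation by \<open>t\<close> inverts \<open>s t\<close>. In the induction the middle
  factor \<open>(s t) t (s t)\<close> collapses to \<open>t\<close>.\<close>

lemma dihedral_conj:
  assumes "s \<in> S" "t \<in> S"
  shows "(s \<otimes> t) [^] (n::nat) \<otimes> (t \<otimes> (s \<otimes> t) [^] n) = t"
proof (induction n)
  case (Suc n)
  let ?a = "s \<otimes> t" and ?b = "(s \<otimes> t) [^] n"
  have "?a [^] Suc n \<otimes> (t \<otimes> ?a [^] Suc n) = (?b \<otimes> ?a) \<otimes> (t \<otimes> (?a \<otimes> ?b))"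
    using assms nat_pow_Suc2[of ?a n] by simp
  also have "\<dots> = ?b \<otimes> (t \<otimes> ?b)"
    using assms by (simp add: m_assoc)
  finally show ?case using Suc by simp
qed (use assms in simp)

text \<open>Numbered from the right starting at 0, the letters of the word contribute the elements
  \<open>t (s t)^i\<close>. Each induction step puts the two letters \<open>s\<close>,
  \<open>t\<close> in front and so adds the indices \<open>2 * n\<close> and
  \<open>2 * n + 1\<close>.\<close>

lemma odd_refl_dihedral:
  assumes "s \<in> S" "t \<in> S" "r \<in> carrier W"
  shows "odd_refl (concat (replicate n [s, t])) r =
    odd (card {i. i < 2 * n \<and> r = t \<otimes> (s \<otimes> t) [^] i})"
proof (induction n)
  case (Suc n)
  let ?a = "s \<otimes> t" and ?P = "\<lambda>i. r = t \<otimes> (s \<otimes> t) [^] (i::nat)"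
  let ?b = "?a [^] n"
  have [simp]: "?b \<in> carrier W" "s \<in> carrier W" "t \<in> carrier W"
    using assms by auto
  have b: "?b \<otimes> (t \<otimes> ?b) = t"
    using dihedral_conj assms by blast
  \<comment> \<open>For the new letter \<open>t\<close>, standing before the product
    \<open>?b\<close>: the solution \<open>r\<close> of \<open>?b r = t ?b\<close> is the element
    with index \<open>2 * n\<close>.\<close>
  have b1: "?b \<otimes> (t \<otimes> ?a [^] (2 * n)) = t \<otimes> ?b"
  proof -
    have "?b \<otimes> (t \<otimes> ?a [^] (2 * n)) = ?b \<otimes> (t \<otimes> ?b) \<otimes> ?b"
      using assms by (simp add: m_assoc nat_pow_mult mult_2)
    then show ?thesis using b by simp
  qed
  have "?b \<otimes> r = ?b \<otimes> (t \<otimes> ?a [^] (2 * n)) \<longleftrightarrow> ?P (2 * n)"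
    using assms by (intro Units_l_cancel) simp_all
  then have 1: "?b \<otimes> r = t \<otimes> ?b \<longleftrightarrow> ?P (2 * n)"
    by (simp only: b1)
  \<comment> \<open>For the new letter \<open>s\<close>, standing before the product
    \<open>t ?b\<close>: here the solution has index \<open>2 * n + 1\<close>.\<close>
  have "t \<otimes> ?b \<otimes> (t \<otimes> ?a [^] Suc (2 * n)) = t \<otimes> (?b \<otimes> (t \<otimes> ?a [^] (2 * n))) \<otimes> ?a"
    using assms by (simp add: m_assoc)
  also have "\<dots> = t \<otimes> (t \<otimes> ?b) \<otimes> ?a"
    by (simp only: b1)
  also have "\<dots> = ?b \<otimes> ?a"
    using assms by simp
  also have "\<dots> = s \<otimes> (t \<otimes> ?b)"
    using assms nat_pow_Suc2[of ?a n] by (simp add: m_assoc)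
  finally have b2: "t \<otimes> ?b \<otimes> (t \<otimes> ?a [^] Suc (2 * n)) = s \<otimes> (t \<otimes> ?b)" .
  have "t \<otimes> ?b \<otimes> r = t \<otimes> ?b \<otimes> (t \<otimes> ?a [^] Suc (2 * n)) \<longleftrightarrow> ?P (Suc (2 * n))"
    using assms by (intro Units_l_cancel) simp_all
  then have 2: "t \<otimes> ?b \<otimes> r = s \<otimes> (t \<otimes> ?b) \<longleftrightarrow> ?P (Suc (2 * n))"
    by (simp only: b2)
  have double: "2 * Suc n = Suc (Suc (2 * n))" by simp
  have "odd (card {i. i < 2 * Suc n \<and> ?P i}) \<longleftrightarrow>
      ((odd (card {i. i < 2 * n \<and> ?P i}) \<noteq> ?P (2 * n)) \<noteq> ?P (Suc (2 * n)))"
    unfolding double odd_card_Suc ..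
  moreover have "odd_refl (concat (replicate (Suc n) [s, t])) r \<longleftrightarrow>
      ((odd_refl (concat (replicate n [s, t])) r \<noteq> (?b \<otimes> r = t \<otimes> ?b))
        \<noteq> (t \<otimes> ?b \<otimes> r = s \<otimes> (t \<otimes> ?b)))"
    using assms by (simp add: wprod_dihedral)
  ultimately show ?case
    unfolding 1 2 Suc.IH by simp
qed simp

text \<open>The sequence \<open>t (s t)^i\<close> has period \<open>ord (s \<otimes> t)\<close>, and
  the relator runs through exactly two periods, so every element occurs an even number of times. For
  infinite order the relator is the empty word.\<close>

lemma odd_refl_relation:
  assumes "s \<in> S" "t \<in> S" "r \<in> carrier W"
  shows "\<not> odd_refl (concat (replicate (ord (s \<otimes> t)) [s, t])) r"
proof -
  have "(s \<otimes> t) [^] (i + ord (s \<otimes> t)) = (s \<otimes> t) [^] i" for i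
    using assms by (simp flip: nat_pow_mult)
  then show ?thesis
    unfolding odd_refl_dihedral[OF assms] by (simp add: even_card_periodic)
qed

text \<open>An inserted relator has product 1, so it does not change the conjugating elements for
  the letters before it, and it contributes evenly itself.\<close>

lemma odd_refl_cong:
  assumes "coxeter_cong W S xs ys" "r \<in> carrier W"
  shows "odd_refl xs r = odd_refl ys r"
  using assms(1)
proof (induction rule: coxeter_cong.induct)
  case (relation s t xs ys)
  let ?d = "concat (replicate (ord (s \<otimes> t)) [s, t])"
  have d: "?d \<in> lists S" "wprod ?d = \<one>"
    using relation by (auto simp: wprod_dihedral)
  have "\<not> odd_refl ?d r'" if "r' \<in> carrier W" for r'
    using odd_refl_relation relation that by blast
  then show ?case
    using relation d assms(2)
    by (simp add: odd_refl_append wprod_append del: in_lists_conv_set)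
qed auto

text \<open>For a reflection \<open>t\<close> this is membership in the right inversion set of
  \<open>w\<close>. One word suffices because \<open>presentation\<close> makes the parity the same
  for all words of \<open>w\<close>, as \<open>inversion_wprod\<close> records.\<close>

definition inversion :: "'a \<Rightarrow> 'a \<Rightarrow> bool" where
  "inversion w t \<longleftrightarrow> (\<exists>ws \<in> lists S. wprod ws = w \<and> odd_refl ws t)"

lemma inversion_wprod:
  "\<lbrakk>ws \<in> lists S; t \<in> carrier W\<rbrakk> \<Longrightarrow> inversion (wprod ws) t = odd_refl ws t"
  unfolding inversion_def using odd_refl_cong presentation by blast

lemma inversion_mult:
  assumes "x \<in> carrier W" "y \<in> carrier W" "t \<in> carrier W"
  shows "inversion (x \<otimes> y) t = (inversion x (y \<otimes> t \<otimes> inv y) \<noteq> inversion y t)"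
proof -
  obtain xs ys where "xs \<in> lists S" "wprod xs = x" "ys \<in> lists S" "wprod ys = y"
    using word_exists assms by metis
  moreover from this have "xs @ ys \<in> lists S" "wprod (xs @ ys) = x \<otimes> y"
    using wprod_append by auto
  ultimately show ?thesis
    using assms inversion_wprod odd_refl_append
    by (metis inv_closed m_closed)
qed

lemma inversion_one: "t \<in> carrier W \<Longrightarrow> \<not> inversion \<one> t"
  using inversion_wprod[of "[]" t] by simp

lemma inversion_gen:
  assumes "s \<in> S" "t \<in> carrier W"
  shows "inversion s t \<longleftrightarrow> t = s"
  using inversion_wprod[of "[s]" t] assms by simp

section \<open>Reflections, exchange and comparison of lengths\<close>

lemma reflection_cases:
  assumes "t \<in> reflections W S"
  obtains x s where "x \<in> carrier W" "s \<in> S" "t = x \<otimes> s \<otimes> inv x"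
  using assms unfolding reflections_def by blast

lemma reflection_carrier [simp]: "t \<in> reflections W S \<Longrightarrow> t \<in> carrier W"
  by (auto elim: reflection_cases)

lemma reflection_square [simp]:
  assumes "t \<in> reflections W S"
  shows "t \<otimes> t = \<one>"
proof -
  obtain x s where [simp]: "x \<in> carrier W" "s \<in> S" and t: "t = x \<otimes> s \<otimes> inv x"
    using assms by (rule reflection_cases)
  show ?thesis
    unfolding t by (simp add: m_assoc)
qed

lemma reflection_inv [simp]: "t \<in> reflections W S \<Longrightarrow> inv t = t"
  by (simp add: inv_equality)

lemma gen_reflection: "s \<in> S \<Longrightarrow> s \<in> reflections W S"
  unfolding reflections_def by (auto intro!: exI[of _ "\<one>"] exI[of _ s])

lemma reflection_conj:
  assumes "t \<in> reflections W S" "y \<in> carrier W"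
  shows "y \<otimes> t \<otimes> inv y \<in> reflections W S"
proof -
  obtain x s where [simp]: "x \<in> carrier W" "s \<in> S" and t: "t = x \<otimes> s \<otimes> inv x"
    using assms(1) by (rule reflection_cases)
  have "y \<otimes> t \<otimes> inv y = (y \<otimes> x) \<otimes> s \<otimes> inv (y \<otimes> x)"
    unfolding t using assms by (simp add: m_assoc inv_mult_group)
  moreover have "y \<otimes> x \<in> carrier W"
    using assms by simp
  ultimately show ?thesis
    using \<open>s \<in> S\<close> unfolding reflections_def by (intro CollectI exI conjI)
qed

text \<open>Write \<open>t = x s x^-1\<close> and apply the cocycle identity to
  \<open>(x s) x^-1\<close>. The contributions of \<open>x\<close> and \<open>x^-1\<close> cancel,
  which leaves that of \<open>s\<close> at \<open>s\<close>.\<close>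

lemma inversion_self:
  assumes "t \<in> reflections W S"
  shows "inversion t t"
proof -
  obtain x s where [simp]: "x \<in> carrier W" "s \<in> S" and t: "t = x \<otimes> s \<otimes> inv x"
    using assms by (rule reflection_cases)
  have c: "inv x \<otimes> t \<otimes> x = s"
    unfolding t by (simp add: m_assoc)
  have tc: "t \<in> carrier W" using assms by simp
  have "inversion t t = (inversion (x \<otimes> s) s \<noteq> inversion (inv x) t)"
    using inversion_mult[of "x \<otimes> s" "inv x" t] tc c by (simp flip: t)
  also have "inversion (x \<otimes> s) s = (\<not> inversion x s)"
    using inversion_mult[of x s s] by (simp add: inversion_gen)
  \<comment> \<open>The cocycle identity for \<open>x x^-1 = 1\<close>, where 1 has no
    inversions.\<close>
  also have "inversion (inv x) t = inversion x s"
    using inversion_mult[of x "inv x" t] tc c inversion_one[of t] by simp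
  finally show ?thesis by simp
qed

text \<open>Strong exchange: an odd count is nonzero, so some suffix \<open>s # ps\<close> satisfies
  \<open>p t = s p\<close> with \<open>p\<close> the product of \<open>ps\<close>. Deleting that
  \<open>s\<close> then has the effect of multiplying by \<open>t\<close> on the right.\<close>

lemma odd_refl_deletion:
  assumes "odd_refl ws t" "ws \<in> lists S" "t \<in> carrier W"
  shows "\<exists>vs \<in> lists S. length vs < length ws \<and> wprod vs = wprod ws \<otimes> t"
  using assms(1,2)
proof (induction ws)
  case (Cons s ws)
  then have [simp]: "s \<in> carrier W" "s \<in> S" "wprod ws \<in> carrier W" and "ws \<in> lists S"
    by auto
  show ?case
  proof (cases "odd_refl ws t")
    case True
    with Cons obtain vs where "vs \<in> lists S" "length vs < length ws" "wprod vs = wprod ws \<otimes> t"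
      by auto
    then show ?thesis
      using assms(3) by (intro bexI[of _ "s # vs"]) (auto simp: m_assoc)
  next
    case False
    then have "wprod ws \<otimes> t = s \<otimes> wprod ws" using Cons.prems by simp
    then show ?thesis
      using \<open>ws \<in> lists S\<close> assms(3) by (intro bexI[of _ ws]) (auto simp: m_assoc)
  qed
qed simp

lemma inversion_imp_len_less:
  assumes "inversion w t" "w \<in> carrier W" "t \<in> carrier W"
  shows "len (w \<otimes> t) < len w"
proof -
  obtain ws where ws: "ws \<in> lists S" "wprod ws = w" "length ws = len w"
    using reduced_exists assms by (metis reduced_expr_def)
  then have "odd_refl ws t" using assms inversion_wprod by metis
  then obtain vs where "vs \<in> lists S" "length vs < length ws" "wprod vs = wprod ws \<otimes> t"
    using odd_refl_deletion ws assms by metis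
  then show ?thesis using len_le[of vs] ws by simp
qed

text \<open>Since \<open>t\<close> is an inversion of itself, the cocycle identity makes it an
  inversion of exactly one of \<open>w\<close> and \<open>w t\<close>. Exchange shortens that one,
  so the two lengths always differ.\<close>

lemma inversion_iff_len_less:
  assumes "w \<in> carrier W" "t \<in> reflections W S"
  shows "inversion w t \<longleftrightarrow> len (w \<otimes> t) < len w"
    and "\<not> inversion w t \<longleftrightarrow> len w < len (w \<otimes> t)"
proof -
  have t: "t \<in> carrier W" using assms by simp
  have "t \<otimes> t \<otimes> inv t = t" "w \<otimes> t \<otimes> t = w"
    using assms by (simp_all add: m_assoc)
  then have "inversion (w \<otimes> t) t = (\<not> inversion w t)"
    using inversion_mult[of w t t] inversion_self[of t] assms by simp
  then have "inversion w t \<or> len w < len (w \<otimes> t)"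
    using inversion_imp_len_less[of "w \<otimes> t" t] assms \<open>w \<otimes> t \<otimes> t = w\<close> by auto
  with inversion_imp_len_less[of w t] assms
  show "inversion w t \<longleftrightarrow> len (w \<otimes> t) < len w"
    and "\<not> inversion w t \<longleftrightarrow> len w < len (w \<otimes> t)"
    by auto
qed

lemma len_mult_gen_neq:
  assumes "w \<in> carrier W" "s \<in> S"
  shows "len (w \<otimes> s) \<noteq> len w"
  using inversion_iff_len_less[OF assms(1) gen_reflection[OF assms(2)]] by auto

subsection \<open>The Bruhat order and the lifting property\<close>

abbreviation ble :: "'a \<Rightarrow> 'a \<Rightarrow> bool" (infix "\<preceq>" 50) where
  "x \<preceq> y \<equiv> bruhat_le W S x y"

lemma ble_refl [simp]: "x \<in> carrier W \<Longrightarrow> x \<preceq> x"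
  by (simp add: bruhat_le_def)

lemma ble_trans: "\<lbrakk>x \<preceq> y; y \<preceq> z\<rbrakk> \<Longrightarrow> x \<preceq> z"
  by (auto simp: bruhat_le_def)

lemma ble_carrier:
  assumes "x \<preceq> y"
  shows "x \<in> carrier W" "y \<in> carrier W"
proof -
  show x: "x \<in> carrier W" using assms by (simp add: bruhat_le_def)
  have "(bruhat_step W S)\<^sup>*\<^sup>* x y" using assms by (simp add: bruhat_le_def)
  then show "y \<in> carrier W"
    using x by induction (auto simp: bruhat_step_def)
qed

lemma ble_len:
  assumes "x \<preceq> y"
  shows "x = y \<or> len x < len y"
proof -
  have "(bruhat_step W S)\<^sup>*\<^sup>* x y" using assms by (simp add: bruhat_le_def)
  then show ?thesis
    by induction (auto simp: bruhat_step_def)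
qed

lemma ble_antisym: "\<lbrakk>x \<preceq> y; y \<preceq> x\<rbrakk> \<Longrightarrow> x = y"
  using ble_len[of x y] ble_len[of y x] by auto

lemma ble_reflection:
  assumes "x \<in> carrier W" "t \<in> reflections W S" "len x < len (x \<otimes> t)"
  shows "x \<preceq> x \<otimes> t"
  using assms unfolding bruhat_le_def bruhat_step_def by blast

lemma ble_gen_up: "\<lbrakk>x \<in> carrier W; s \<in> S; len x < len (x \<otimes> s)\<rbrakk> \<Longrightarrow> x \<preceq> x \<otimes> s"
  by (simp add: ble_reflection gen_reflection)

lemma ble_gen_down: "\<lbrakk>x \<in> carrier W; s \<in> S; len (x \<otimes> s) < len x\<rbrakk> \<Longrightarrow> x \<otimes> s \<preceq> x"
  using ble_gen_up[of "x \<otimes> s" s] by simp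

abbreviation dn :: "'a \<Rightarrow> 'a \<Rightarrow> 'a" where "dn \<equiv> down_simple W S"

text \<open>The Demazure product with a generator, dual to \<open>dn\<close>. It is needed for the
  backward direction of \<open>ble_mult_gen_iff\<close>.\<close>

definition up_simple :: "'a \<Rightarrow> 'a \<Rightarrow> 'a" where
  "up_simple v s = (if len (v \<otimes> s) < len v then v else v \<otimes> s)"

lemma dn_eq:
  assumes "v \<in> carrier W" "s \<in> S"
  shows "dn v s = (if len (v \<otimes> s) < len v then v \<otimes> s else v)"
  using ble_gen_down[OF assms] ble_len[of "v \<otimes> s" v]
  by (auto simp: down_simple_def bruhat_less_def)

text \<open>The lifting property in monotone form. If \<open>t = s\<close>, multiplication by
  \<open>s\<close> swaps \<open>x\<close> and \<open>y\<close>. Otherwise \<open>x s\<close> is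
  below \<open>y s\<close> through the reflection \<open>s t s\<close>; with \<open>x\<close> below
  \<open>y\<close>, the lower of \<open>x\<close>, \<open>x s\<close> is below both \<open>y\<close>
  and \<open>y s\<close>, and dually for the upper.\<close>

lemma dn_up_mono_step:
  assumes "x \<in> carrier W" "bruhat_step W S x y" "s \<in> S"
  shows "dn x s \<preceq> dn y s \<and> up_simple x s \<preceq> up_simple y s"
proof -
  from assms(2) obtain t where t: "t \<in> reflections W S" and y: "y = x \<otimes> t" and l: "len x < len y"
    by (auto simp: bruhat_step_def)
  have tc: "t \<in> carrier W" and yc: "y \<in> carrier W" and xs: "x \<otimes> s \<in> carrier W"
    using t y assms by auto
  have xy: "x \<preceq> y" using ble_reflection t l y assms by blast
  note up = ble_gen_up[OF assms(1,3)] ble_gen_up[OF yc assms(3)]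
  note down = ble_gen_down[OF assms(1,3)] ble_gen_down[OF yc assms(3)]
  note neq = len_mult_gen_neq[OF assms(1,3)] len_mult_gen_neq[OF yc assms(3)]
  show ?thesis
  proof (cases "t = s")
    case True
    then have "y \<otimes> s = x" "x \<otimes> s = y" using y assms by auto
    then show ?thesis
      using l assms yc by (simp add: dn_eq up_simple_def)
  next
    case False
    let ?r = "s \<otimes> t \<otimes> s"
    have r: "?r \<in> reflections W S"
      using reflection_conj[OF t, of s] assms by simp
    have "s \<otimes> ?r \<otimes> inv s = t" using tc assms by (simp add: m_assoc)
    moreover have "?r \<noteq> s"
    proof
      assume "?r = s"
      then have "s \<otimes> t = \<one>" using assms tc by (metis S_cancel(2) S_square S_carrier m_closed)
      then show False using False assms tc by (metis S_cancel(1) S_carrier r_one)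
    qed
    moreover have "\<not> inversion x t"
      using inversion_iff_len_less[OF assms(1) t] l y by simp
    \<comment> \<open>The only inversion of \<open>s\<close> is \<open>s\<close>, so the cocycle identity for \<open>x \<otimes> s\<close> transports
        the non-inversion \<open>t\<close> of \<open>x\<close> to a non-inversion of \<open>x \<otimes> s\<close>.\<close>
    ultimately have "\<not> inversion (x \<otimes> s) ?r"
      using inversion_mult[of x s ?r] inversion_gen[of s ?r] assms tc by simp
    moreover have "x \<otimes> s \<otimes> ?r = y \<otimes> s"
      using assms tc by (simp add: y m_assoc)
    ultimately have "x \<otimes> s \<preceq> y \<otimes> s"
      using inversion_iff_len_less[OF xs r] ble_reflection[OF xs r] by simp
    then show ?thesis
      using xy up down neq assms yc
      by (auto simp: dn_eq up_simple_def not_less intro: ble_trans dest!: le_neq_implies_less)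
  qed
qed

lemma dn_up_mono:
  assumes "x \<preceq> y" "s \<in> S"
  shows "dn x s \<preceq> dn y s \<and> up_simple x s \<preceq> up_simple y s"
proof -
  have x: "x \<in> carrier W" and "(bruhat_step W S)\<^sup>*\<^sup>* x y"
    using assms by (auto simp: bruhat_le_def)
  from this(2) show ?thesis
  proof induction
    case base
    show ?case using x assms(2) by (simp add: dn_eq up_simple_def)
  next
    case (step y z)
    then have "y \<in> carrier W"
      using x ble_carrier(2)[of x y] by (simp add: bruhat_le_def)
    then show ?case
      using step dn_up_mono_step assms(2) ble_trans by blast
  qed
qed

lemma dn_le:
  assumes "x \<in> carrier W" "s \<in> S"
  shows "dn x s \<preceq> x" "dn x s \<preceq> x \<otimes> s"
  using assms ble_gen_down[OF assms] ble_gen_up[OF assms] len_mult_gen_neq[OF assms]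
  by (auto simp: dn_eq)

lemma le_up:
  assumes "x \<in> carrier W" "s \<in> S"
  shows "x \<preceq> up_simple x s" "x \<otimes> s \<preceq> up_simple x s"
  using assms ble_gen_down[OF assms] ble_gen_up[OF assms] len_mult_gen_neq[OF assms]
  by (auto simp: up_simple_def)

text \<open>Forward, apply \<open>dn\<close> to both sides, as \<open>dn (w s) s = w\<close>;
  backward, apply \<open>up_simple\<close>. The lower interval of \<open>w s\<close> is thus that of
  \<open>w\<close> joined with its right translate by \<open>s\<close>, which drives the induction
  along a reduced word.\<close>

lemma ble_mult_gen_iff:
  assumes "w \<in> carrier W" "s \<in> S" "len w < len (w \<otimes> s)" "y \<in> carrier W"
  shows "y \<preceq> w \<otimes> s \<longleftrightarrow> y \<preceq> w \<or> y \<otimes> s \<preceq> w"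
proof
  assume "y \<preceq> w \<otimes> s"
  then have "dn y s \<preceq> dn (w \<otimes> s) s" using dn_up_mono assms by blast
  also have "dn (w \<otimes> s) s = w" using assms by (simp add: dn_eq)
  finally show "y \<preceq> w \<or> y \<otimes> s \<preceq> w"
    using assms by (auto simp: dn_eq split: if_splits)
next
  have w: "up_simple w s = w \<otimes> s" using assms by (simp add: up_simple_def)
  assume "y \<preceq> w \<or> y \<otimes> s \<preceq> w"
  then show "y \<preceq> w \<otimes> s"
  proof
    assume "y \<preceq> w"
    then show ?thesis using le_up(1)[of w s] w assms ble_trans by metis
  next
    assume "y \<otimes> s \<preceq> w"
    then have "up_simple (y \<otimes> s) s \<preceq> w \<otimes> s" using dn_up_mono w assms by metis
    moreover have "y \<preceq> up_simple (y \<otimes> s) s" using le_up(2)[of "y \<otimes> s" s] assms by simp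
    ultimately show ?thesis using ble_trans by blast
  qed
qed

subsection \<open>The down operation as a Bruhat minimum\<close>

text \<open>A relation rather than a function: existence comes from running \<open>dn\<close> along
  a reduced word, uniqueness from antisymmetry, and the two together give independence of the
  word.\<close>

definition is_min :: "'a \<Rightarrow> 'a \<Rightarrow> 'a \<Rightarrow> bool" where
  "is_min v w d \<longleftrightarrow> (\<exists>y. y \<preceq> w \<and> d = v \<otimes> y) \<and> (\<forall>y. y \<preceq> w \<longrightarrow> d \<preceq> v \<otimes> y)"

lemma is_min_unique: "\<lbrakk>is_min v w d; is_min v w e\<rbrakk> \<Longrightarrow> d = e"
  unfolding is_min_def by (metis ble_antisym)

text \<open>If \<open>z\<close> is below \<open>w s\<close>, then \<open>z\<close> or
  \<open>z s\<close> is below \<open>w\<close>, so \<open>d\<close> is below \<open>v z\<close> or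
  \<open>v z s\<close>. Applying the monotone map \<open>dn\<close> puts \<open>dn d s\<close> below
  \<open>v z\<close> in either case.\<close>

lemma is_min_mult_gen:
  assumes "v \<in> carrier W" "w \<in> carrier W" "s \<in> S" "len w < len (w \<otimes> s)" "is_min v w d"
  shows "is_min v (w \<otimes> s) (dn d s)"
  unfolding is_min_def
proof (intro conjI allI impI)
  obtain y where y: "y \<preceq> w" "d = v \<otimes> y" using assms by (auto simp: is_min_def)
  have yc: "y \<in> carrier W" using y ble_carrier by blast
  then have "y \<preceq> w \<otimes> s" "y \<otimes> s \<preceq> w \<otimes> s"
    using y assms ble_mult_gen_iff by auto
  then show "\<exists>y. y \<preceq> w \<otimes> s \<and> dn d s = v \<otimes> y"
    using y yc assms by (auto simp: dn_eq m_assoc)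
next
  fix z assume z: "z \<preceq> w \<otimes> s"
  then have zc: "z \<in> carrier W" using ble_carrier by blast
  with z assms have "z \<preceq> w \<or> z \<otimes> s \<preceq> w" using ble_mult_gen_iff by blast
  then show "dn d s \<preceq> v \<otimes> z"
  proof
    assume "z \<preceq> w"
    then have "d \<preceq> v \<otimes> z" using assms by (auto simp: is_min_def)
    then have "dn d s \<preceq> dn (v \<otimes> z) s" using assms dn_up_mono by blast
    moreover have "dn (v \<otimes> z) s \<preceq> v \<otimes> z" using assms zc dn_le by simp
    ultimately show ?thesis using ble_trans by blast
  next
    assume "z \<otimes> s \<preceq> w"
    then have "d \<preceq> v \<otimes> (z \<otimes> s)" using assms by (auto simp: is_min_def)
    then have "dn d s \<preceq> dn (v \<otimes> (z \<otimes> s)) s" using assms dn_up_mono by blast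
    moreover have "dn (v \<otimes> (z \<otimes> s)) s \<preceq> v \<otimes> z"
      using assms zc dn_le(2)[of "v \<otimes> (z \<otimes> s)" s] by (simp add: m_assoc)
    ultimately show ?thesis using ble_trans by blast
  qed
qed

lemma foldl_dn_is_min:
  assumes "v \<in> carrier W" "ws \<in> lists S" "length ws = len (wprod ws)"
  shows "is_min v (wprod ws) (foldl dn v ws)"
  using assms(2,3)
proof (induction ws rule: rev_induct)
  case Nil
  have "y \<preceq> \<one> \<longleftrightarrow> y = \<one>" for y using ble_len[of y "\<one>"] by auto
  then show ?case using assms(1) by (auto simp: is_min_def)
next
  case (snoc s ws)
  then have ws: "ws \<in> lists S" "s \<in> S" "wprod (ws @ [s]) = wprod ws \<otimes> s"
    by (auto simp: wprod_append)
  \<comment> \<open>A generator adds at most one to the length, so a prefix of a reduced word is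
    reduced and the last letter raises the length.\<close>
  then have "length ws = len (wprod ws)" "len (wprod ws) < len (wprod ws \<otimes> s)"
    using len_mult_gen[of "wprod ws" s] len_le[of ws] snoc.prems by auto
  then show ?case
    using snoc.IH ws is_min_mult_gen[of v "wprod ws" s] assms(1) by simp
qed

text \<open>The word \<open>ys\<close> collects the letters that actually act, each of which lowers
  the length by at least one. The opposite bound is left to subadditivity in
  \<open>down_len\<close>.\<close>

lemma foldl_dn_len:
  assumes "v \<in> carrier W" "ws \<in> lists S"
  shows "\<exists>ys \<in> lists S. foldl dn v ws = v \<otimes> wprod ys \<and> length ys + len (foldl dn v ws) \<le> len v"
  using assms(2)
proof (induction ws rule: rev_induct)
  case Nil
  then show ?case using assms(1) by (auto intro!: bexI[of _ "[]"])
next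
  case (snoc s ws)
  then have ws: "s \<in> S" by auto
  let ?d = "foldl dn v ws"
  obtain ys where ys: "ys \<in> lists S" "?d = v \<otimes> wprod ys" "length ys + len ?d \<le> len v"
    using snoc by auto
  have dc: "?d \<in> carrier W" using ys assms(1) by simp
  show ?case
  proof (cases "len (?d \<otimes> s) < len ?d")
    case True
    then show ?thesis
      using ys ws dc assms(1)
      by (intro bexI[of _ "ys @ [s]"]) (auto simp: dn_eq wprod_append m_assoc)
  next
    case False
    then show ?thesis using ys ws dc by (intro bexI[of _ ys]) (auto simp: dn_eq)
  qed
qed

text \<open>Every reduced word of \<open>w\<close> computes the same minimum, so the definite
  description in \<open>down\<close> is well defined.\<close>

lemma down_eq_foldl:
  assumes "v \<in> carrier W" "reduced_expr W S ws w"
  shows "down W S v w = foldl dn v ws"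
  unfolding down_def
proof (rule the_equality)
  have *: "is_min v w (foldl dn v xs)" if "reduced_expr W S xs w" for xs
    using foldl_dn_is_min[OF assms(1), of xs] that by (auto simp: reduced_expr_def)
  fix y assume "\<exists>xs. reduced_expr W S xs w \<and> y = foldl dn v xs"
  then show "y = foldl dn v ws"
    using * assms(2) is_min_unique by blast
qed (use assms in blast)

lemma down_is_min:
  assumes "v \<in> carrier W" "w \<in> carrier W"
  shows "is_min v w (down W S v w)"
proof -
  obtain ws where "reduced_expr W S ws w" using reduced_exists assms by blast
  then show ?thesis
    using down_eq_foldl foldl_dn_is_min assms(1) by (auto simp: reduced_expr_def)
qed

lemma down_len:
  assumes "v \<in> carrier W" "w \<in> carrier W"
  shows "len (inv v \<otimes> down W S v w) + len (down W S v w) = len v"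
proof -
  obtain ws where ws: "reduced_expr W S ws w" using reduced_exists assms by blast
  let ?d = "down W S v w"
  obtain ys where ys: "ys \<in> lists S" "?d = v \<otimes> wprod ys" "length ys + len ?d \<le> len v"
    using foldl_dn_len[OF assms(1), of ws] ws
    unfolding down_eq_foldl[OF assms(1) ws] reduced_expr_def by blast
  let ?y = "wprod ys"
  have yc: "?y \<in> carrier W" using ys by simp
  \<comment> \<open>Solving for \<open>v\<close> turns subadditivity into the lower bound for the
    sum of lengths.\<close>
  have "v = ?d \<otimes> inv ?y" using ys(2) yc assms by (simp add: m_assoc)
  then have "len v \<le> len ?d + len ?y"
    using len_mult[of ?d "inv ?y"] ys(2) yc assms by simp
  moreover have "inv v \<otimes> ?d = ?y" using ys(2) yc assms by simp
  ultimately show ?thesis using ys len_le[of ys] by simp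
qed

section \<open>The mixed meet\<close>

lemma mixed_meet:
  assumes u: "u \<in> carrier W" and w: "w \<in> carrier W"
  defines "m \<equiv> u \<otimes> down W S (inv u) w"
  shows "weak_le W S m u" "m \<preceq> w"
    and "\<And>v. \<lbrakk>weak_le W S v u; v \<preceq> w\<rbrakk> \<Longrightarrow> v \<preceq> m"
proof -
  let ?d = "down W S (inv u) w"
  have min: "is_min (inv u) w ?d" using down_is_min u w by simp
  then obtain y where y: "y \<preceq> w" "?d = inv u \<otimes> y" by (auto simp: is_min_def)
  have yc: "y \<in> carrier W" using y ble_carrier by blast
  \<comment> \<open>Multiplication by \<open>u\<close> recovers the element below \<open>w\<close>
    at which the minimum is attained.\<close>
  have my: "m = y" unfolding m_def y(2) using u yc by simp
  show "m \<preceq> w" using my y by simp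
  have dc: "?d \<in> carrier W" using y yc u by simp
  have "inv m \<otimes> u = inv ?d" unfolding my y(2) using u yc by (simp add: inv_mult_group)
  moreover have "len m + len ?d = len u"
    using down_len[of "inv u" w] u w by (simp add: m_def)
  ultimately show "weak_le W S m u"
    using dc u yc my by (simp add: weak_le_def)
  fix v assume v: "weak_le W S v u" "v \<preceq> w"
  then have vc: "v \<in> carrier W" using ble_carrier by blast
  let ?q = "inv u \<otimes> v"
  have qc: "?q \<in> carrier W" using u vc by simp
  have "inv ?q = inv v \<otimes> u" using u vc by (simp add: inv_mult_group)
  then have lq: "len v + len ?q = len u"
    using v qc len_inv[OF qc] by (simp add: weak_le_def)
  have dq: "?d \<preceq> ?q" using min v by (simp add: is_min_def)
  \<comment> \<open>The minimum is used a second time, with \<open>u\<close> and \<open>?q\<close>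
    in the places of \<open>inv u\<close> and \<open>w\<close>.\<close>
  let ?e = "down W S u ?q"
  have mine: "is_min u ?q ?e" using down_is_min u qc by blast
  then obtain z where z: "z \<preceq> ?q" "?e = u \<otimes> z" by (auto simp: is_min_def)
  have zc: "z \<in> carrier W" using z ble_carrier by blast
  have "?e \<preceq> u \<otimes> ?q" using mine qc by (simp add: is_min_def)
  then have ev: "?e \<preceq> v" using u vc by simp
  have "u = ?e \<otimes> inv z" using z zc u by (simp add: m_assoc)
  then have "len u \<le> len ?e + len z"
    using len_mult[of ?e "inv z"] z(2) zc u by simp
  moreover have "len z \<le> len ?q" using ble_len[OF z(1)] by auto
  \<comment> \<open>An element below \<open>v\<close> whose length is at least that of
    \<open>v\<close> equals \<open>v\<close>.\<close>
  ultimately have "?e = v" using ble_len[OF ev] lq by auto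
  then show "v \<preceq> m" using mine dq by (simp add: is_min_def m_def)
qed

end

theorem theorem3:
  fixes W :: "('a, 'b) monoid_scheme" and S :: "'a set" and u w :: 'a
  assumes "coxeter_system W S"
    and "finite (carrier W)"
    and "u \<in> carrier W"
    and "w \<in> carrier W"
  defines "A \<equiv> {x \<in> carrier W. weak_le W S x u \<and> bruhat_le W S x w}"
  shows "\<exists>m. (\<forall>x. (x \<in> A \<and> (\<forall>y \<in> A. bruhat_le W S x y \<longrightarrow> y = x)) \<longleftrightarrow> x = m)
    \<and> weak_le W S m u \<and> bruhat_le W S m w
    \<and> (\<forall>v \<in> carrier W. weak_le W S v u \<and> bruhat_le W S v w \<longrightarrow> bruhat_le W S v m)
    \<and> m = u \<otimes>\<^bsub>W\<^esub> down W S (inv\<^bsub>W\<^esub> u) w"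
proof -
  interpret coxeter_system W S by fact
  let ?m = "u \<otimes>\<^bsub>W\<^esub> down W S (inv\<^bsub>W\<^esub> u) w"
  note m = mixed_meet[OF assms(3,4)]
  have "?m \<in> A" using m(1,2) ble_carrier by (auto simp: A_def)
  moreover have "bruhat_le W S x ?m" if "x \<in> A" for x
    using m(3) that by (auto simp: A_def)
  \<comment> \<open>A greatest element of \<open>A\<close> is its only maximal element, by
    antisymmetry.\<close>
  ultimately have "(x \<in> A \<and> (\<forall>y \<in> A. bruhat_le W S x y \<longrightarrow> y = x)) \<longleftrightarrow> x = ?m" for x
    using ble_antisym by blast
  then show ?thesis using m by blast
qed

end
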